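(* For any convex body $Q$ in the plane $\mathbb{R}^2$, we have $\mu^*_Q > \frac{1}{6}\cdot\Delta(Q)$.
   Context: A convex body in the plane is a compact convex subset of $\mathbb{R}^2$ with nonempty interior. For a measurable set $Q\subset\mathbb{R}^2$ with positive area and a point $p\in\mathbb{R}^2$, let $\mathrm{dist}(p,q)=|pq|$ be Euclidean distance and let $\mu_Q(p)=\frac{\int_{q\in Q}\mathrm{dist}(p,q)\,dq}{\mathrm{area}(Q)}$ be the average distance from $p$ to the points of $Q$. Let $\mu^*_Q=\min\{\mu_Q(p): p\in\mathbb{R}^2\}$ (a point attaining this minimum is a Fermat-Weber center of $Q$). $\Delta(Q)$ denotes the diameter of $Q$, i.e. the maximum Euclidean distance between two points of $Q$. *)

theory Defs
  imports "HOL-Analysis.Analysis"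
begin

definition convex_body :: "(real ^ 2) set \<Rightarrow> bool" where
  "convex_body Q \<longleftrightarrow> compact Q \<and> convex Q \<and> interior Q \<noteq> {}"

text \<open>Only meaningful for measurable sets of positive finite area.\<close>

definition avg_dist :: "(real ^ 2) set \<Rightarrow> real ^ 2 \<Rightarrow> real" where
  "avg_dist Q p = (LINT q:Q|lebesgue. dist p q) / measure lebesgue Q"

text \<open>The infimum is a minimum for every convex body; see \<open>min_avg_dist_attained\<close> below.\<close>

definition min_avg_dist :: "(real ^ 2) set \<Rightarrow> real" where
  "min_avg_dist Q = (INF p. avg_dist Q p)"

lemma avg_dist_minimum_attained:
  assumes "convex_body Q"
  shows "\<exists>p. \<forall>p'. avg_dist Q p \<le> avg_dist Q p'"
proof -
  have c: "compact Q" and i: "interior Q \<noteq> {}"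
    using assms by (auto simp: convex_body_def)
  have Qm: "Q \<in> lmeasurable" using c by (rule lmeasurable_compact)
  have int0: "integrable lborel (\<lambda>q. indicator Q q *\<^sub>R dist p q)" for p
    by (rule borel_integrable_compact[OF c]) (intro continuous_intros)
  have int: "set_integrable lebesgue Q (\<lambda>q. dist p q)" for p
    unfolding set_integrable_def
    using int0[of p] by (rule integrable_completion[THEN iffD2, rotated]) (use int0[of p] in auto)
  have intc: "set_integrable lebesgue Q (\<lambda>q. k)" for k :: real
    unfolding set_integrable_def using Qm
    by (intro integrable_scaleR_left impI integrable_real_indicator) (auto simp: fmeasurable_def)
  have "emeasure lebesgue (interior Q) \<noteq> 0"
    using open_not_negligible[of "interior Q"] i
    by (auto simp: negligible_iff_null_sets null_sets_def)
  then have "measure lebesgue (interior Q) \<noteq> 0"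
    using lmeasurable_interior[OF compact_imp_bounded[OF c]]
    by (metis emeasure_eq_measure2 ennreal_0)
  moreover have "measure lebesgue (interior Q) \<le> measure lebesgue Q"
    by (rule measure_mono_fmeasurable) (use Qm interior_subset in auto)
  ultimately have pos: "measure lebesgue Q > 0"
    using measure_nonneg[of lebesgue "interior Q"] by linarith
  have ic: "(LINT q:Q|lebesgue. k) = k * measure lebesgue Q" for k :: real
    using Qm by (simp add: set_lebesgue_integral_def fmeasurable_def)
  have lip: "avg_dist Q p \<le> avg_dist Q p' + dist p p'" for p p'
  proof -
    have "(LINT q:Q|lebesgue. dist p q) \<le> (LINT q:Q|lebesgue. dist p' q + dist p p')"
      by (rule set_integral_mono[OF int set_integral_add(1)[OF int intc]])
        (metis add.commute dist_triangle)
    also have "\<dots> = (LINT q:Q|lebesgue. dist p' q) + dist p p' * measure lebesgue Q"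
      by (simp add: set_integral_add(2)[OF int intc] ic)
    finally show ?thesis
      using pos by (simp add: avg_dist_def divide_simps algebra_simps)
  qed
  have "continuous_on S (avg_dist Q)" for S
  proof (rule lipschitz_on_continuous_on)
    show "1-lipschitz_on S (avg_dist Q)"
      by (rule lipschitz_onI)
        (use lip in \<open>force simp: dist_real_def abs_le_iff dist_commute algebra_simps\<close>)+
  qed
  obtain q0 where q0: "q0 \<in> Q" using i interior_subset by auto
  define D where "D = diameter Q"
  have D: "dist q0 q \<le> D" if "q \<in> Q" for q
    unfolding D_def by (rule diameter_bounded_bound[OF compact_imp_bounded[OF c] q0 that])
  have D0: "D \<ge> 0" using D[OF q0] by simp
  have up: "avg_dist Q q0 \<le> D"
  proof -
    have "(LINT q:Q|lebesgue. dist q0 q) \<le> (LINT q:Q|lebesgue. D)"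
      by (rule set_integral_mono[OF int intc D])
    then show ?thesis using pos by (simp add: avg_dist_def ic divide_simps)
  qed
  have lo: "dist p q0 - D \<le> avg_dist Q p" for p
  proof -
    have "(LINT q:Q|lebesgue. dist p q0 - D) \<le> (LINT q:Q|lebesgue. dist p q)"
    proof (rule set_integral_mono[OF intc int])
      fix q assume "q \<in> Q"
      then show "dist p q0 - D \<le> dist p q"
        using D[of q] dist_triangle[of p q0 q] by (simp add: dist_commute)
    qed
    then show ?thesis using pos by (simp add: avg_dist_def ic divide_simps)
  qed
  obtain p where p: "p \<in> cball q0 (2 * D)"
    and min: "\<And>p'. p' \<in> cball q0 (2 * D) \<Longrightarrow> avg_dist Q p \<le> avg_dist Q p'"
    using continuous_attains_inf[of "cball q0 (2 * D)" "avg_dist Q"] D0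
      \<open>continuous_on (cball q0 (2 * D)) (avg_dist Q)\<close> by auto
  have "avg_dist Q p \<le> avg_dist Q p'" for p'
  proof (cases "p' \<in> cball q0 (2 * D)")
    case False
    then have "D < avg_dist Q p'" using lo[of p'] by (simp add: dist_commute)
    then show ?thesis using min[of q0] up D0 by simp
  qed (rule min)
  then show ?thesis by blast
qed

lemma min_avg_dist_attained:
  assumes "convex_body Q"
  shows "\<exists>p. avg_dist Q p = min_avg_dist Q \<and> (\<forall>p'. avg_dist Q p \<le> avg_dist Q p')"
proof -
  obtain p where p: "\<And>p'. avg_dist Q p \<le> avg_dist Q p'"
    using avg_dist_minimum_attained[OF assms] by blast
  then have "min_avg_dist Q = avg_dist Q p"
    unfolding min_avg_dist_def by (intro cInf_eq_minimum) auto
  with p show ?thesis by auto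
qed

end

theory Submission
  imports Defs "HOL-Probability.Distribution_Functions"
begin

text \<open>
  Let \<open>a\<close>, \<open>b\<close> be points of a compact convex set \<open>K\<close> at maximal distance \<open>D\<close>, and let \<open>u\<close> be the
  unit vector pointing from \<open>a\<close> to \<open>b\<close>. Replacing the distance \<open>dist p q\<close> by the distance
  \<open>\<bar>u \<bullet> q - u \<bullet> p\<bar>\<close> of the projections to the line through \<open>a\<close> and \<open>b\<close> can only make the integral
  smaller, and all of \<open>K\<close> projects between \<open>a\<close> and \<open>b\<close>, because \<open>D\<close> is the diameter. So it suffices
  to bound the mean distance of the projections from an arbitrary level \<open>c\<close>.

  Such a mean is smallest at a median, so cut \<open>K\<close> by a hyperplane \<open>u \<bullet> q = m\<close> into two parts of
  equal measure (\<open>halving_hyperplane\<close>). In dimension \<open>n\<close>, consider the part containing \<open>a\<close>, of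
  extent \<open>l\<close> in direction \<open>u\<close>. It is star-shaped about \<open>a\<close>, so the homothety with centre \<open>a\<close> and
  ratio \<open>t\<close> maps it into its own points of height at most \<open>t * l\<close> above \<open>a\<close>; these therefore
  carry at least the fraction \<open>t ^ n\<close> of the measure (\<open>measure_low_part_ge\<close>). Integrating over \<open>t\<close>
  shows that the mean height above \<open>a\<close> is at most \<open>n / (n + 1) * l\<close>, as for a cone with apex \<open>a\<close>
  (\<open>integral_height_le\<close>); hence the mean distance from the cutting hyperplane is at least
  \<open>l / (n + 1)\<close>. The same holds for the part containing \<open>b\<close>, and the two extents add up to \<open>D\<close>, so
  the mean over \<open>K\<close> is at least \<open>D / (2 * (n + 1))\<close> (\<open>integral_abs_height_ge\<close>). For \<open>n = 2\<close> this
  is \<open>D / 6\<close>.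

  Strictness comes from the first step: for \<open>n \<ge> 2\<close>, a point has the same distance from \<open>p\<close> as its
  projection only if it lies on the line through \<open>p\<close> in direction \<open>u\<close>, which is a null set
  (\<open>integral_dist_gt_integral_abs_height\<close>).
\<close>

section \<open>Mean height of a star-shaped set\<close>

text \<open>The double integral of the indicator of the region \<open>W\<close> under the graph of \<open>h\<close>, in both orders.\<close>

lemma nn_integral_layer_cake:
  fixes h :: "'a::euclidean_space \<Rightarrow> real"
  assumes [measurable]: "h \<in> borel_measurable borel" "S \<in> sets borel"
  shows "(\<integral>\<^sup>+q\<in>S. ennreal (h q) \<partial>lborel) =
         (\<integral>\<^sup>+s\<in>{0..}. emeasure lborel {q \<in> S. s < h q} \<partial>lborel)"
proof -
  define W where "W = {(q, s). q \<in> S \<and> 0 \<le> s \<and> s < h q}"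
  have "W = {p \<in> space (borel \<Otimes>\<^sub>M borel). fst p \<in> S \<and> 0 \<le> snd p \<and> snd p < h (fst p)}"
    by (auto simp: W_def space_pair_measure)
  also have "\<dots> \<in> sets (borel \<Otimes>\<^sub>M borel)"
    by measurable
  finally have W [measurable]: "W \<in> sets (borel \<Otimes>\<^sub>M borel)" .
  have "(\<integral>\<^sup>+q\<in>S. ennreal (h q) \<partial>lborel) = (\<integral>\<^sup>+q. \<integral>\<^sup>+s. indicator W (q, s) \<partial>lborel \<partial>lborel)"
  proof (rule nn_integral_cong)
    fix q :: 'a
    have "(\<integral>\<^sup>+s. indicator W (q, s) \<partial>lborel) = (\<integral>\<^sup>+s. indicator S q * indicator {0..<h q} s \<partial>lborel)"
      by (intro nn_integral_cong) (auto simp: W_def split: split_indicator)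
    also have "\<dots> = ennreal (h q) * indicator S q"
      by (cases "0 \<le> h q") (auto split: split_indicator simp: ennreal_neg)
    finally show "ennreal (h q) * indicator S q = (\<integral>\<^sup>+s. indicator W (q, s) \<partial>lborel)" ..
  qed
  also have "\<dots> = (\<integral>\<^sup>+s. \<integral>\<^sup>+q. indicator W (q, s) \<partial>lborel \<partial>lborel)"
    by (rule lborel_pair.Fubini'[symmetric]) (use W in simp)
  also have "\<dots> = (\<integral>\<^sup>+s\<in>{0..}. emeasure lborel {q \<in> S. s < h q} \<partial>lborel)"
  proof (rule nn_integral_cong)
    fix s :: real
    have "{q \<in> space borel. q \<in> S \<and> s < h q} \<in> sets borel"
      by measurable
    then have [measurable]: "{q \<in> S. s < h q} \<in> sets borel"
      by simp
    have "(\<integral>\<^sup>+q. indicator W (q, s) \<partial>lborel) =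
        (\<integral>\<^sup>+q. indicator {0..} s * indicator {q \<in> S. s < h q} q \<partial>lborel)"
      by (intro nn_integral_cong) (auto simp: W_def split: split_indicator)
    also have "\<dots> = emeasure lborel {q \<in> S. s < h q} * indicator {0..} s"
      by (simp add: nn_integral_cmult mult.commute)
    finally show "(\<integral>\<^sup>+q. indicator W (q, s) \<partial>lborel) =
        emeasure lborel {q \<in> S. s < h q} * indicator {0..} s" .
  qed
  finally show ?thesis .
qed

text \<open>
  The homothety with centre \<open>a\<close> and ratio \<open>t\<close> multiplies measures by \<open>t ^ DIM('a)\<close> and heights
  above \<open>a\<close> by \<open>t\<close>, and it maps \<open>S\<close> into itself.
\<close>

lemma measure_low_part_ge:
  fixes S :: "'a::euclidean_space set"
  assumes S: "compact S"
    and star: "\<And>q. q \<in> S \<Longrightarrow> closed_segment a q \<subseteq> S"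
    and height: "\<And>q. q \<in> S \<Longrightarrow> u \<bullet> (q - a) \<le> L"
    and t: "0 \<le> t" "t \<le> 1"
  shows "t ^ DIM('a) * measure lborel S \<le> measure lborel {q \<in> S. u \<bullet> (q - a) \<le> t * L}"
proof -
  let ?f = "\<lambda>q. t *\<^sub>R q + (1 - t) *\<^sub>R a"
  have fS: "compact (?f ` S)"
    by (intro compact_continuous_image continuous_intros S)
  have low: "compact {q \<in> S. u \<bullet> (q - a) \<le> t * L}"
  proof -
    have "closed {q. u \<bullet> (q - a) \<le> t * L}"
      by (intro closed_Collect_le continuous_intros)
    then have "compact (S \<inter> {q. u \<bullet> (q - a) \<le> t * L})"
      using S by (rule compact_Int_closed[rotated])
    then show ?thesis
      by (simp add: Int_def)
  qed
  have "t ^ DIM('a) * measure lborel S = measure lborel (?f ` S)"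
    using measure_lebesgue_affine[of t "(1 - t) *\<^sub>R a" S] t
      borel_compact[OF S] borel_compact[OF fS]
    by (simp add: measure_completion)
  also have "\<dots> \<le> measure lborel {q \<in> S. u \<bullet> (q - a) \<le> t * L}"
  proof (rule measure_mono_fmeasurable)
    show "?f ` S \<subseteq> {q \<in> S. u \<bullet> (q - a) \<le> t * L}"
    proof (intro image_subsetI CollectI conjI)
      fix q assume q: "q \<in> S"
      have "?f q \<in> closed_segment a q"
        using t by (auto simp: in_segment intro!: exI[of _ t])
      with star[OF q] show "?f q \<in> S" ..
      have "u \<bullet> (?f q - a) = t * (u \<bullet> (q - a))"
        by (simp add: algebra_simps inner_simps)
      also have "\<dots> \<le> t * L"
        using height[OF q] t by (intro mult_left_mono)
      finally show "u \<bullet> (?f q - a) \<le> t * L" .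
    qed
  qed (use fS low in \<open>auto intro: fmeasurable_compact borel_compact\<close>)
  finally show ?thesis .
qed

text \<open>
  By the layer cake formula the integral is the integral over \<open>s\<close> of the measure of the points
  higher than \<open>s\<close>. The homothety of ratio \<open>s / L\<close> bounds that measure by
  \<open>(1 - (s / L) ^ DIM('a)) * measure lborel S\<close>, with equality for a cone with apex \<open>a\<close>
  whose base lies at height \<open>L\<close>.
\<close>

lemma integral_height_le:
  fixes S :: "'a::euclidean_space set"
  assumes S: "compact S"
    and star: "\<And>q. q \<in> S \<Longrightarrow> closed_segment a q \<subseteq> S"
    and height: "\<And>q. q \<in> S \<Longrightarrow> 0 \<le> u \<bullet> (q - a) \<and> u \<bullet> (q - a) \<le> L"
    and "0 \<le> L"
  shows "(LINT q:S|lborel. u \<bullet> (q - a)) \<le> real DIM('a) / (real DIM('a) + 1) * L * measure lborel S"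
proof (cases "L = 0")
  case True
  have "(\<lambda>q. indicator S q *\<^sub>R (u \<bullet> (q - a))) = (\<lambda>q. 0)"
    using height True by (auto simp: fun_eq_iff indicator_def intro: antisym)
  then show ?thesis
    using True unfolding set_lebesgue_integral_def by simp
next
  case False
  with \<open>0 \<le> L\<close> have L: "0 < L" by simp
  define n where "n = DIM('a)"
  define V where "V = measure lborel S"
  have Sb [measurable]: "S \<in> sets borel"
    using S by (rule borel_compact)
  have high: "emeasure lborel {q \<in> S. s < u \<bullet> (q - a)} * indicator {0..} s
      \<le> ennreal (V * (1 - (s / L) ^ n)) * indicator {0..L} s" for s
  proof (cases "0 \<le> s \<and> s \<le> L")
    case True
    have "(s / L) ^ n * V \<le> measure lborel {q \<in> S. u \<bullet> (q - a) \<le> s / L * L}"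
      unfolding n_def V_def
      by (rule measure_low_part_ge) (use S star height L True in auto)
    then have low: "(s / L) ^ n * V \<le> measure lborel {q \<in> S. u \<bullet> (q - a) \<le> s}"
      using L by simp
    have "{q \<in> space borel. q \<in> S \<and> u \<bullet> (q - a) \<le> s} \<in> sets borel"
      by measurable
    then have lowb: "{q \<in> S. u \<bullet> (q - a) \<le> s} \<in> sets borel"
      by simp
    have eq: "{q \<in> S. s < u \<bullet> (q - a)} = S - {q \<in> S. u \<bullet> (q - a) \<le> s}"
      by auto
    have fin: "{q \<in> S. s < u \<bullet> (q - a)} \<in> fmeasurable lborel"
      by (rule fmeasurableI2[OF fmeasurable_compact[OF S]]) (use lowb Sb eq in auto)
    have "measure lborel {q \<in> S. s < u \<bullet> (q - a)} = V - measure lborel {q \<in> S. u \<bullet> (q - a) \<le> s}"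
      unfolding eq V_def
      by (rule measure_Diff) (use fmeasurable_compact[OF S] lowb in \<open>auto simp: fmeasurable_def\<close>)
    also have "\<dots> \<le> V * (1 - (s / L) ^ n)"
      using low by (simp add: algebra_simps)
    finally show ?thesis
      using fin True by (simp add: emeasure_eq_measure2 ennreal_leI)
  next
    case False
    then have "s < 0 \<or> {q \<in> S. s < u \<bullet> (q - a)} = {}"
      using height by force
    then show ?thesis
    proof
      assume "s < 0"
      then show ?thesis by simp
    next
      assume empty: "{q \<in> S. s < u \<bullet> (q - a)} = {}"
      show ?thesis unfolding empty by simp
    qed
  qed
  have int: "set_integrable lborel S (\<lambda>q. u \<bullet> (q - a))"
    unfolding set_integrable_def
    by (rule borel_integrable_compact[OF S]) (intro continuous_intros)
  have "ennreal (LINT q:S|lborel. u \<bullet> (q - a)) = (\<integral>\<^sup>+q. ennreal (indicator S q *\<^sub>R (u \<bullet> (q - a))) \<partial>lborel)"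
    unfolding set_lebesgue_integral_def
    by (rule nn_integral_eq_integral[symmetric])
      (use int height in \<open>auto simp: set_integrable_def split: split_indicator\<close>)
  also have "\<dots> = (\<integral>\<^sup>+q\<in>S. ennreal (u \<bullet> (q - a)) \<partial>lborel)"
    by (intro nn_integral_cong) (auto split: split_indicator)
  also have "\<dots> = (\<integral>\<^sup>+s\<in>{0..}. emeasure lborel {q \<in> S. s < u \<bullet> (q - a)} \<partial>lborel)"
    by (rule nn_integral_layer_cake) measurable
  also have "\<dots> \<le> (\<integral>\<^sup>+s\<in>{0..L}. ennreal (V * (1 - (s / L) ^ n)) \<partial>lborel)"
    by (intro nn_integral_mono high)
  also have "\<dots> = ennreal (V * L - V / L ^ n * (L ^ Suc n / Suc n) - (V * 0 - V / L ^ n * (0 ^ Suc n / Suc n)))"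
  proof (rule nn_integral_FTC_Icc)
    fix s assume s: "s \<in> {0..L}"
    have "((\<lambda>s. V * s - V / L ^ n * (s ^ Suc n / Suc n)) has_real_derivative V - V / L ^ n * s ^ n) (at s)"
      using L by (auto intro!: derivative_eq_intros simp del: power_Suc)
    then show "((\<lambda>s. V * s - V / L ^ n * (s ^ Suc n / Suc n)) has_real_derivative V * (1 - (s / L) ^ n)) (at s)"
      using L by (simp add: power_divide algebra_simps)
    have "(s / L) ^ n \<le> 1"
      using s L by (intro power_le_one) auto
    then show "0 \<le> V * (1 - (s / L) ^ n)"
      by (simp add: V_def)
  qed (use L in auto)
  also have "V * L - V / L ^ n * (L ^ Suc n / Suc n) - (V * 0 - V / L ^ n * (0 ^ Suc n / Suc n)) = n / (n + 1) * L * V"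
    using L by (simp add: field_simps)
  finally show ?thesis
    using L by (simp add: V_def n_def add.commute)
qed

section \<open>Cutting at a median\<close>

text \<open>
  The measure of the part of \<open>S\<close> below level \<open>x\<close> is the distribution function of the image of
  Lebesgue measure on \<open>S\<close> under \<open>q \<mapsto> u \<bullet> q\<close>. Hyperplanes are null sets, so this image has no atoms,
  its distribution function is continuous, and the intermediate value theorem applies.
\<close>

lemma halving_hyperplane:
  fixes S :: "'a::euclidean_space set"
  assumes S: "compact S" and u: "u \<noteq> 0"
    and range: "\<And>q. q \<in> S \<Longrightarrow> \<alpha> \<le> u \<bullet> q \<and> u \<bullet> q \<le> \<beta>" and "\<alpha> \<le> \<beta>"
  obtains m where "\<alpha> \<le> m" "m \<le> \<beta>"
    "measure lborel {q \<in> S. u \<bullet> q \<le> m} = measure lborel S / 2"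
    "measure lborel {q \<in> S. m \<le> u \<bullet> q} = measure lborel S / 2"
proof -
  have Sb [measurable]: "S \<in> sets borel"
    using S by (rule borel_compact)
  have Sf: "S \<in> fmeasurable lborel"
    using S by (rule fmeasurable_compact)
  define M where "M = distr (restrict_space lborel S) borel (\<lambda>q. u \<bullet> q)"
  have u_meas: "(\<lambda>q. u \<bullet> q) \<in> restrict_space lborel S \<rightarrow>\<^sub>M borel"
    by (intro measurable_restrict_space1) measurable
  interpret R: finite_measure "restrict_space lborel S"
    using Sf by (intro finite_measureI) (auto simp: space_restrict_space emeasure_restrict_space fmeasurable_def)
  interpret M: finite_borel_measure M
    unfolding M_def finite_borel_measure_def finite_borel_measure_axioms_def
    using R.finite_measure_distr[OF u_meas] by simp
  have slice: "measure M X = measure lborel {q \<in> S. u \<bullet> q \<in> X}" if "X \<in> sets borel" for X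
    unfolding M_def
    by (subst measure_distr[OF u_meas that], subst measure_restrict_space)
      (auto simp: space_restrict_space intro!: arg_cong[of _ _ "measure lborel"])
  have plane: "measure lborel {q \<in> S. u \<bullet> q = x} = 0" for x
  proof -
    have "measure lebesgue {q \<in> S. u \<bullet> q = x} = 0"
      by (intro negligible_imp_measure0 negligible_subset[OF negligible_hyperplane[of u x]]) (use u in auto)
    moreover have "{q \<in> space borel. q \<in> S \<and> u \<bullet> q = x} \<in> sets borel"
      by measurable
    ultimately show ?thesis
      by (simp add: measure_completion)
  qed
  have cont: "isCont (cdf M) x" for x
    using slice[of "{x}"] plane by (simp add: M.isCont_cdf)
  have cdf: "cdf M x = measure lborel {q \<in> S. u \<bullet> q \<le> x}" for x
    using slice[of "{..x}"] by (simp add: cdf_def)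
  have "{q \<in> S. u \<bullet> q \<le> \<alpha>} = {q \<in> S. u \<bullet> q = \<alpha>}" "{q \<in> S. u \<bullet> q \<le> \<beta>} = S"
    using range by force+
  then have "cdf M \<alpha> = 0" "cdf M \<beta> = measure lborel S"
    using plane by (simp_all add: cdf)
  then obtain m where m: "\<alpha> \<le> m" "m \<le> \<beta>" "cdf M m = measure lborel S / 2"
    using IVT[of "cdf M" \<alpha> "measure lborel S / 2" \<beta>] cont \<open>\<alpha> \<le> \<beta>\<close> by auto
  have "measure M (space M) = measure M {..m} + measure M {m..} - measure M {m}"
  proof -
    have "measure M (space M) = measure M {..<m} + measure M {m..}"
      by (subst M.finite_measure_Union[symmetric]) (auto simp: M.borel_UNIV intro!: arg_cong[of _ _ "measure M"])
    moreover have "measure M {..m} = measure M {..<m} + measure M {m}"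
      by (subst M.finite_measure_Union[symmetric]) (auto intro!: arg_cong[of _ _ "measure M"])
    ultimately show ?thesis by simp
  qed
  then have "measure lborel {q \<in> S. m \<le> u \<bullet> q} = measure lborel S / 2"
    using m(3) plane[of m]
    by (simp add: M.borel_UNIV slice cdf_def)
  with m that show thesis
    by (simp add: cdf)
qed

text \<open>
  For the halving level \<open>m\<close> this is the cone bound on the two halves. A different level \<open>c\<close>
  changes the lower bounds for the two halves by \<open>c - m\<close> and \<open>m - c\<close> times the same measure, so
  their sum stays the same.
\<close>

lemma integral_abs_height_ge:
  fixes K :: "'a::euclidean_space set"
  assumes K: "compact K" "convex K" and ab: "a \<in> K" "b \<in> K" "u \<bullet> a < u \<bullet> b"
    and range: "\<And>q. q \<in> K \<Longrightarrow> u \<bullet> a \<le> u \<bullet> q \<and> u \<bullet> q \<le> u \<bullet> b"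
  shows "(u \<bullet> b - u \<bullet> a) / (2 * (real DIM('a) + 1)) * measure lborel K \<le> (LINT q:K|lborel. \<bar>u \<bullet> q - c\<bar>)"
proof -
  define n where "n = real DIM('a)"
  define V where "V = measure lborel K"
  have u: "u \<noteq> 0"
    using ab by auto
  obtain m where m: "u \<bullet> a \<le> m" "m \<le> u \<bullet> b"
    "measure lborel {q \<in> K. u \<bullet> q \<le> m} = V / 2"
    "measure lborel {q \<in> K. m \<le> u \<bullet> q} = V / 2"
    using halving_hyperplane[of K u "u \<bullet> a" "u \<bullet> b"] K(1) u range ab(3) unfolding V_def by force
  \<comment> \<open>With \<open>v = u\<close>, \<open>z = a\<close>, \<open>k = c - u \<bullet> a\<close> the integrand is \<open>c - u \<bullet> q\<close>; with \<open>v = - u\<close>, \<open>z = b\<close>,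
      \<open>k = u \<bullet> b - c\<close> it is \<open>u \<bullet> q - c\<close>.\<close>
  have half: "(k - n / (n + 1) * l) * (V / 2) \<le> (LINT q:S|lborel. k - v \<bullet> (q - z))"
    if S: "compact S" "convex S" "measure lborel S = V / 2" and "z \<in> S" "0 \<le> l"
      and "\<And>q. q \<in> S \<Longrightarrow> 0 \<le> v \<bullet> (q - z) \<and> v \<bullet> (q - z) \<le> l" for S :: "'a set" and l v z k
  proof -
    have "(LINT q:S|lborel. v \<bullet> (q - z)) \<le> n / (n + 1) * l * (V / 2)"
      unfolding n_def S(3)[symmetric]
      by (rule integral_height_le) (use that in \<open>auto simp: closed_segment_subset\<close>)
    moreover have "(LINT q:S|lborel. k - v \<bullet> (q - z)) =
        (LINT q:S|lborel. k) - (LINT q:S|lborel. v \<bullet> (q - z))"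
      by (rule set_integral_diff)
        (unfold set_integrable_def, (rule borel_integrable_compact[OF S(1)], intro continuous_intros)+)
    moreover have "(LINT q:S|lborel. k) = k * (V / 2)"
      using fmeasurable_compact[OF S(1)] S(3)
      by (simp add: set_lebesgue_integral_def fmeasurable_def)
    ultimately show ?thesis
      unfolding left_diff_distrib by linarith
  qed
  define A where "A = {q \<in> K. u \<bullet> q \<le> m}"
  define B where "B = {q \<in> K. m \<le> u \<bullet> q}"
  have "A = K \<inter> {q. u \<bullet> q \<le> m}" "B = K \<inter> {q. u \<bullet> q \<ge> m}"
    by (auto simp: A_def B_def)
  then have AB: "compact A" "convex A" "compact B" "convex B"
    using K by (auto intro!: compact_Int_closed convex_Int closed_halfspace_le closed_halfspace_ge
        convex_halfspace_le convex_halfspace_ge)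
  have A: "(c - u \<bullet> a - n / (n + 1) * (m - u \<bullet> a)) * (V / 2) \<le> (LINT q:A|lborel. c - u \<bullet> q)"
    using half[of A a "m - u \<bullet> a" u "c - u \<bullet> a"] AB m ab range
    by (simp add: A_def inner_diff_right)
  have B: "(u \<bullet> b - c - n / (n + 1) * (u \<bullet> b - m)) * (V / 2) \<le> (LINT q:B|lborel. u \<bullet> q - c)"
    using half[of B b "u \<bullet> b - m" "- u" "u \<bullet> b - c"] AB m ab range
    by (simp add: B_def inner_diff_right)
  have int: "integrable lborel (\<lambda>q. indicator A q *\<^sub>R (c - u \<bullet> q))"
    "integrable lborel (\<lambda>q. indicator B q *\<^sub>R (u \<bullet> q - c))"
    "integrable lborel (\<lambda>q. indicator K q *\<^sub>R \<bar>u \<bullet> q - c\<bar>)"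
    by (intro borel_integrable_compact AB K continuous_intros)+
  have "(u \<bullet> b - u \<bullet> a) / (2 * (n + 1)) * V =
      (c - u \<bullet> a - n / (n + 1) * (m - u \<bullet> a)) * (V / 2) +
      (u \<bullet> b - c - n / (n + 1) * (u \<bullet> b - m)) * (V / 2)"
  proof -
    define r where "r = 1 / (n + 1)"
    have r: "n / (n + 1) = 1 - r" "(u \<bullet> b - u \<bullet> a) / (2 * (n + 1)) = (u \<bullet> b - u \<bullet> a) * r / 2"
      by (simp_all add: r_def n_def field_simps)
    show ?thesis
      unfolding r by (simp add: field_simps)
  qed
  also have "\<dots> \<le> (LINT q:A|lborel. c - u \<bullet> q) + (LINT q:B|lborel. u \<bullet> q - c)"
    using A B by (rule add_mono)
  also have "\<dots> = (LINT q|lborel. indicator A q *\<^sub>R (c - u \<bullet> q) + indicator B q *\<^sub>R (u \<bullet> q - c))"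
    unfolding set_lebesgue_integral_def using int by simp
  also have "\<dots> \<le> (LINT q:K|lborel. \<bar>u \<bullet> q - c\<bar>)"
    unfolding set_lebesgue_integral_def
  proof (rule integral_mono)
    fix q
    \<comment> \<open>On the common face of \<open>A\<close> and \<open>B\<close> the two terms cancel, so the overlap does no harm.\<close>
    show "indicator A q *\<^sub>R (c - u \<bullet> q) + indicator B q *\<^sub>R (u \<bullet> q - c) \<le> indicator K q *\<^sub>R \<bar>u \<bullet> q - c\<bar>"
      by (auto simp: A_def B_def split: split_indicator)
  qed (use int in auto)
  finally show ?thesis
    by (simp add: n_def V_def add.commute)
qed

section \<open>Comparing distances with their projections\<close>

text \<open>
  Equality in the Cauchy-Schwarz inequality for \<open>u\<close> and \<open>q - p\<close> forces \<open>q - p\<close> to be parallel to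
  \<open>u\<close>. In dimension at least two there is a nonzero \<open>y\<close> orthogonal to \<open>u\<close>, so all such \<open>q\<close> lie in
  one hyperplane orthogonal to \<open>y\<close>, and they cannot fill a set of positive measure.
\<close>

lemma integral_dist_gt_integral_abs_height:
  fixes K :: "'a::euclidean_space set"
  assumes K: "compact K" "measure lborel K > 0" and dim: "2 \<le> DIM('a)" and u: "norm u = 1"
  shows "(LINT q:K|lborel. \<bar>u \<bullet> q - u \<bullet> p\<bar>) < (LINT q:K|lborel. dist p q)"
proof -
  obtain y where y: "y \<noteq> 0" "orthogonal u y"
    using dim by (rule orthogonal_to_vector_exists)
  have le: "\<bar>u \<bullet> q - u \<bullet> p\<bar> \<le> dist p q" for q
    using Cauchy_Schwarz_ineq2[of u "q - p"] u
    by (simp add: inner_diff_right dist_norm norm_minus_commute)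
  have plane: "y \<bullet> q = y \<bullet> p" if "\<bar>u \<bullet> q - u \<bullet> p\<bar> = dist p q" for q
  proof -
    have "\<bar>u \<bullet> (q - p)\<bar> = norm u * norm (q - p)"
      using that u by (simp add: inner_diff_right dist_norm norm_minus_commute)
    then have "q - p = norm (q - p) *\<^sub>R u \<or> q - p = - norm (q - p) *\<^sub>R u"
      using u unfolding norm_cauchy_schwarz_abs_eq by auto
    then have "y \<bullet> (q - p) = 0"
      using y(2) by (metis inner_commute inner_scaleR_right mult_zero_right orthogonal_def)
    then show ?thesis
      by (simp add: inner_diff_right)
  qed
  define f where "f q = indicator K q *\<^sub>R (dist p q - \<bar>u \<bullet> q - u \<bullet> p\<bar>)" for q
  have int: "integrable lborel (\<lambda>q. indicator K q *\<^sub>R dist p q)"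
    "integrable lborel (\<lambda>q. indicator K q *\<^sub>R \<bar>u \<bullet> q - u \<bullet> p\<bar>)"
    by (intro borel_integrable_compact K continuous_intros)+
  then have f: "integrable lborel f"
    "integral\<^sup>L lborel f = (LINT q:K|lborel. dist p q) - (LINT q:K|lborel. \<bar>u \<bullet> q - u \<bullet> p\<bar>)"
    by (simp_all add: f_def[abs_def] set_lebesgue_integral_def scaleR_diff_right del: real_scaleR_def)
  have f0: "0 \<le> f q" for q
    using le[of q] by (simp add: f_def)
  have "integral\<^sup>L lborel f \<noteq> 0"
  proof
    assume "integral\<^sup>L lborel f = 0"
    then have "AE q in lborel. f q = 0"
      using integral_nonneg_eq_0_iff_AE[OF f(1)] f0 by simp
    moreover have "AE q in lborel. y \<bullet> q \<noteq> y \<bullet> p"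
    proof -
      have "negligible {q. y \<bullet> q = y \<bullet> p}"
        using y(1) by (intro negligible_hyperplane) auto
      moreover have "{q. y \<bullet> q = y \<bullet> p} \<in> sets borel"
        by (intro borel_closed closed_hyperplane)
      ultimately show ?thesis
        by (intro AE_I'[of "{q. y \<bullet> q = y \<bullet> p}"])
          (auto simp: negligible_iff_null_sets null_sets_completion_iff)
    qed
    ultimately have "AE q in lborel. q \<notin> K"
    proof eventually_elim
      case (elim q)
      then show ?case
        using plane[of q] by (auto simp: f_def)
    qed
    then have "measure lborel K = 0"
      using borel_compact[OF K(1)] by (simp add: AE_iff_measurable[where N = K] measure_def)
    with K(2) show False by simp
  qed
  moreover have "0 \<le> integral\<^sup>L lborel f"
    using f0 by simp
  ultimately show ?thesis
    using f(2) by linarith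
qed

section \<open>Mean distance and diameter\<close>

theorem integral_dist_gt_diameter:
  fixes K :: "'a::euclidean_space set"
  assumes K: "compact K" "convex K" "measure lborel K > 0" and dim: "2 \<le> DIM('a)"
  shows "diameter K / (2 * (real DIM('a) + 1)) * measure lborel K < (LINT q:K|lborel. dist p q)"
proof -
  have "K \<noteq> {}"
    using K by auto
  then obtain a b where ab: "a \<in> K" "b \<in> K" "dist a b = diameter K"
    using diameter_compact_attained[OF K(1)] by blast
  have D: "norm (b - a) = diameter K"
    using ab(3) by (simp add: dist_norm norm_minus_commute)
  have diam: "norm (q - r) \<le> diameter K" if "q \<in> K" "r \<in> K" for q r
    using diameter_bounded_bound[OF compact_imp_bounded[OF K(1)] that] by (simp add: dist_norm)
  have "a \<noteq> b"
  proof
    assume "a = b"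
    then have "q = a" if "q \<in> K" for q
      using diam[OF that ab(1)] D by simp
    then have "K = {a}"
      using ab(1) by blast
    with K(3) show False by simp
  qed
  define u where "u = sgn (b - a)"
  have "norm u = 1"
    using \<open>a \<noteq> b\<close> by (simp add: u_def norm_sgn)
  have "u \<bullet> (b - a) = norm (b - a)"
    using \<open>a \<noteq> b\<close> by (simp add: u_def sgn_div_norm dot_square_norm power2_eq_square)
  then have "u \<bullet> b - u \<bullet> a = diameter K"
    using D by (simp add: inner_diff_right)
  note u = \<open>norm u = 1\<close> this
  \<comment> \<open>No two points of \<open>K\<close> are further apart in direction \<open>u\<close> than \<open>a\<close> and \<open>b\<close>; taking one of the
      two to be \<open>a\<close> or \<open>b\<close>, all of \<open>K\<close> lies between the levels of \<open>a\<close> and \<open>b\<close>.\<close>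
  have proj: "u \<bullet> q - u \<bullet> r \<le> u \<bullet> b - u \<bullet> a" if "q \<in> K" "r \<in> K" for q r
  proof -
    have "u \<bullet> (q - r) \<le> norm (q - r)"
      using norm_cauchy_schwarz[of u "q - r"] u(1) by simp
    also have "\<dots> \<le> u \<bullet> b - u \<bullet> a"
      using diam[OF that] u(2) by simp
    finally show ?thesis
      by (simp add: inner_diff_right)
  qed
  have "diameter K / (2 * (real DIM('a) + 1)) * measure lborel K \<le> (LINT q:K|lborel. \<bar>u \<bullet> q - u \<bullet> p\<bar>)"
    unfolding u(2)[symmetric]
  proof (rule integral_abs_height_ge)
    show "u \<bullet> a < u \<bullet> b"
      using u(2) ab(3) \<open>a \<noteq> b\<close> by (metis diff_gt_0_iff_gt zero_less_dist_iff)
    show "u \<bullet> a \<le> u \<bullet> q \<and> u \<bullet> q \<le> u \<bullet> b" if "q \<in> K" for q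
      using proj[of b q] proj[of q a] that ab by auto
  qed (use K ab in auto)
  also have "\<dots> < (LINT q:K|lborel. dist p q)"
    using K(1,3) dim u(1) by (rule integral_dist_gt_integral_abs_height)
  finally show ?thesis .
qed

theorem theorem1:
  fixes Q :: "(real ^ 2) set"
  assumes "convex_body Q"
  shows "min_avg_dist Q > 1 / 6 * diameter Q"
proof -
  have Q: "compact Q" "convex Q" "interior Q \<noteq> {}"
    using assms by (auto simp: convex_body_def)
  have Qb: "Q \<in> sets borel"
    using Q(1) by (rule borel_compact)
  have "measure lebesgue Q \<noteq> 0"
    using negligible_convex_interior[OF Q(2)] Q(3) negligible_iff_measure[of Q] lmeasurable_compact[OF Q(1)]
    by blast
  then have pos: "measure lborel Q > 0"
    using Qb measure_nonneg[of lborel Q] by (simp add: measure_completion less_le del: measure_nonneg)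
  obtain p where p: "avg_dist Q p = min_avg_dist Q"
    using min_avg_dist_attained[OF assms] by blast
  have "integrable lborel (\<lambda>q. indicator Q q *\<^sub>R dist p q)"
    by (intro borel_integrable_compact Q continuous_intros)
  then have "(LINT q:Q|lebesgue. dist p q) = (LINT q:Q|lborel. dist p q)"
    unfolding set_lebesgue_integral_def
    by (intro integral_completion borel_measurable_integrable)
  then have "avg_dist Q p = (LINT q:Q|lborel. dist p q) / measure lborel Q"
    using Qb by (simp add: avg_dist_def measure_completion)
  moreover have "diameter Q / 6 * measure lborel Q < (LINT q:Q|lborel. dist p q)"
    using integral_dist_gt_diameter[OF Q(1,2) pos, of p] by simp
  ultimately show ?thesis
    using pos p by (simp add: pos_less_divide_eq)
qed

end
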